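(* Let $\Omega$ be a non-empty open subset of $\ell^2$. If $\Omega$ satisfies the finitely convex condition, then $\Omega$ satisfies the strong segment condition.
   Context: $\ell^2$ is the real Hilbert space of square-summable sequences. Fix positive numbers $(a_i)_{i\ge1}$ with $\sum_i a_i<\infty$. $\widetilde H=\{\mathbf x=(x_i)\in\ell^2:\sum_i x_i^2/a_i^4<\infty\}$. $\ell^2_F$ is the set of $\mathbf x\in\ell^2$ with only finitely many nonzero coordinates. Finitely convex condition: for any $\mathbf x,\mathbf y\in\Omega$ with $\mathbf x-\mathbf y\in\ell^2_F$, one has $\{t\mathbf x+(1-t)\mathbf y:t\in[0,1]\}\subset\Omega$. Strong segment condition: for every $\mathbf x\in\partial\Omega$ there exist a neighbourhood $U_{\mathbf x}\subset\ell^2$ of $\mathbf x$ and a nonzero vector $\mathbf y_{\mathbf x}\in\widetilde H$ such that $\mathbf z+t\mathbf y_{\mathbf x}\in\Omega$ for all $\mathbf z\in\overline\Omega\cap U_{\mathbf x}$ and all $t\in(0,1)$. *)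

theory Defs
  imports "HOL-Analysis.Analysis"
begin

text \<open>Coordinates are numbered from \<open>0\<close>: \<open>coord x i\<close> is the coordinate with number \<open>i + 1\<close>
  in the numbering that starts from \<open>1\<close>.\<close>

typedef ell2 = "{x :: nat \<Rightarrow> real. summable (\<lambda>i. (x i)\<^sup>2)}"
  morphisms coord Abs_ell2
  by (rule exI[of _ "\<lambda>_. 0"]) simp

lemma ell2_eqI: "(\<And>i. coord x i = coord y i) \<Longrightarrow> x = y"
  by (metis coord_inject ext)

lemma summable_coord_sq: "summable (\<lambda>i. (coord x i)\<^sup>2)"
  using coord[of x] by simp

lemma summable_mult_of_sq:
  fixes f g :: "nat \<Rightarrow> real"
  assumes "summable (\<lambda>i. (f i)\<^sup>2)" "summable (\<lambda>i. (g i)\<^sup>2)"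
  shows "summable (\<lambda>i. f i * g i)"
proof (rule summable_comparison_test')
  show "summable (\<lambda>i. (f i)\<^sup>2 + (g i)\<^sup>2)"
    using assms by (rule summable_add)
  fix i :: nat
  have "2 * (\<bar>f i\<bar> * \<bar>g i\<bar>) \<le> (f i)\<^sup>2 + (g i)\<^sup>2"
    using sum_squares_bound[of "\<bar>f i\<bar>" "\<bar>g i\<bar>"] by simp
  moreover have "0 \<le> \<bar>f i\<bar> * \<bar>g i\<bar>" by simp
  ultimately show "norm (f i * g i) \<le> (f i)\<^sup>2 + (g i)\<^sup>2"
    unfolding real_norm_def abs_mult by linarith
qed

lemma summable_sq_add:
  fixes f g :: "nat \<Rightarrow> real"
  assumes "summable (\<lambda>i. (f i)\<^sup>2)" "summable (\<lambda>i. (g i)\<^sup>2)"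
  shows "summable (\<lambda>i. (f i + g i)\<^sup>2)"
proof -
  have "summable (\<lambda>i. (f i)\<^sup>2 + (g i)\<^sup>2 + 2 * (f i * g i))"
    by (intro summable_add summable_mult summable_mult_of_sq assms)
  then show ?thesis by (simp add: power2_sum mult.assoc)
qed

lemma summable_sq_scale:
  fixes f :: "nat \<Rightarrow> real"
  assumes "summable (\<lambda>i. (f i)\<^sup>2)"
  shows "summable (\<lambda>i. (c * f i)\<^sup>2)"
  using assms by (simp add: power_mult_distrib summable_mult)

instantiation ell2 :: real_vector
begin

definition "0 = Abs_ell2 (\<lambda>_. 0)"
definition "x + y = Abs_ell2 (\<lambda>i. coord x i + coord y i)"
definition "- x = Abs_ell2 (\<lambda>i. - coord x i)"
definition "x - y = Abs_ell2 (\<lambda>i. coord x i - coord y i)"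
definition "c *\<^sub>R x = Abs_ell2 (\<lambda>i. c * coord x i)"

lemma coord_zero [simp]: "coord 0 i = 0"
  by (simp add: zero_ell2_def Abs_ell2_inverse)

lemma coord_add [simp]: "coord (x + y) i = coord x i + coord y i"
  by (simp add: plus_ell2_def Abs_ell2_inverse summable_sq_add summable_coord_sq)

lemma coord_uminus [simp]: "coord (- x) i = - coord x i"
  by (simp add: uminus_ell2_def Abs_ell2_inverse summable_coord_sq)

lemma coord_diff [simp]: "coord (x - y) i = coord x i - coord y i"
  using summable_sq_add[of "coord x" "\<lambda>i. - coord y i"]
  by (simp add: minus_ell2_def Abs_ell2_inverse summable_coord_sq)

lemma coord_scaleR [simp]: "coord (c *\<^sub>R x) i = c * coord x i"
  by (simp add: scaleR_ell2_def Abs_ell2_inverse summable_sq_scale summable_coord_sq)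

instance
  by standard (auto intro!: ell2_eqI simp: algebra_simps)

end

instantiation ell2 :: real_inner
begin

definition "inner x y = (\<Sum>i. coord x i * coord y i)"
definition "norm (x :: ell2) = sqrt (inner x x)"
definition "sgn (x :: ell2) = x /\<^sub>R norm x"
definition "dist (x :: ell2) y = norm (x - y)"
definition [code del]:
  "(uniformity :: (ell2 \<times> ell2) filter) = (INF e\<in>{0 <..}. principal {(x, y). dist x y < e})"
definition [code del]:
  "open (U :: ell2 set) \<longleftrightarrow> (\<forall>x\<in>U. eventually (\<lambda>(x', y). x' = x \<longrightarrow> y \<in> U) uniformity)"

lemma summable_coord_mult: "summable (\<lambda>i. coord x i * coord y i)"
  by (intro summable_mult_of_sq summable_coord_sq)

instance
proof
  fix x y z :: ell2 and r :: real and U :: "ell2 set"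
  show "dist x y = norm (x - y)"
    by (rule dist_ell2_def)
  show "sgn x = x /\<^sub>R norm x"
    by (rule sgn_ell2_def)
  show "(uniformity :: (ell2 \<times> ell2) filter) = (INF e\<in>{0 <..}. principal {(x, y). dist x y < e})"
    by (rule uniformity_ell2_def)
  show "open U \<longleftrightarrow> (\<forall>x\<in>U. eventually (\<lambda>(x', y). x' = x \<longrightarrow> y \<in> U) uniformity)"
    by (rule open_ell2_def)
  show "inner x y = inner y x"
    by (simp add: inner_ell2_def mult.commute)
  show "inner (x + y) z = inner x z + inner y z"
    by (simp add: inner_ell2_def distrib_right suminf_add summable_coord_mult)
  show "inner (r *\<^sub>R x) y = r * inner x y"
    by (simp add: inner_ell2_def mult.assoc suminf_mult summable_coord_mult)
  show "0 \<le> inner x x"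
    by (simp add: inner_ell2_def suminf_nonneg summable_coord_mult)
  show "inner x x = 0 \<longleftrightarrow> x = 0"
  proof
    assume "inner x x = 0"
    then have "\<forall>i. coord x i * coord x i = 0"
      unfolding inner_ell2_def
      using suminf_eq_zero_iff[OF summable_coord_mult[of x x]] by simp
    then show "x = 0" by (intro ell2_eqI) simp
  qed (simp add: inner_ell2_def)
  show "norm x = sqrt (inner x x)"
    by (rule norm_ell2_def)
qed

end

lemma norm_ell2: "norm (x :: ell2) = sqrt (\<Sum>i. (coord x i)\<^sup>2)"
  by (simp add: norm_ell2_def inner_ell2_def power2_eq_square)

lemma norm_ell2_sq: "(norm (x :: ell2))\<^sup>2 = (\<Sum>i. (coord x i)\<^sup>2)"
  by (simp add: norm_ell2 suminf_nonneg summable_coord_sq)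

lemma sum_coord_sq_le: "(\<Sum>i<k. (coord x i)\<^sup>2) \<le> (norm x)\<^sup>2"
  unfolding norm_ell2_sq by (rule sum_le_suminf[OF summable_coord_sq]) auto

lemma abs_coord_le_norm: "\<bar>coord x i\<bar> \<le> norm x"
proof -
  have "(coord x i)\<^sup>2 \<le> (\<Sum>j<Suc i. (coord x j)\<^sup>2)"
    by (rule member_le_sum) auto
  also have "\<dots> \<le> (norm x)\<^sup>2" by (rule sum_coord_sq_le)
  finally show ?thesis using abs_le_square_iff[of "coord x i" "norm x"] by simp
qed

instance ell2 :: complete_space
proof
  fix X :: "nat \<Rightarrow> ell2"
  assume X: "Cauchy X"
  have "Cauchy (\<lambda>n. coord (X n) i)" for i
  proof (rule CauchyI)
    fix e :: real assume "0 < e"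
    with X obtain M where M: "\<forall>m\<ge>M. \<forall>n\<ge>M. norm (X m - X n) < e"
      by (meson CauchyD)
    have "norm (coord (X m) i - coord (X n) i) < e" if "m \<ge> M" "n \<ge> M" for m n
      using M that abs_coord_le_norm[of "X m - X n" i] by force
    then show "\<exists>M. \<forall>m\<ge>M. \<forall>n\<ge>M. norm (coord (X m) i - coord (X n) i) < e" by blast
  qed
  then have "\<forall>i. \<exists>l. (\<lambda>n. coord (X n) i) \<longlonglongrightarrow> l"
    by (simp add: Cauchy_convergent_iff convergent_def)
  then obtain l where l: "\<And>i. (\<lambda>n. coord (X n) i) \<longlonglongrightarrow> l i" by metis
  have tail: "\<exists>M. \<forall>m\<ge>M. \<forall>k. (\<Sum>i<k. (coord (X m) i - l i)\<^sup>2) \<le> e\<^sup>2" if e: "0 < e" for e :: real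
  proof -
    from X e obtain M where M: "\<forall>m\<ge>M. \<forall>n\<ge>M. norm (X m - X n) < e"
      by (meson CauchyD)
    have "(\<Sum>i<k. (coord (X m) i - l i)\<^sup>2) \<le> e\<^sup>2" if m: "m \<ge> M" for m k
    proof (rule LIMSEQ_le_const2)
      show "(\<lambda>n. \<Sum>i<k. (coord (X m) i - coord (X n) i)\<^sup>2) \<longlonglongrightarrow> (\<Sum>i<k. (coord (X m) i - l i)\<^sup>2)"
        by (intro tendsto_intros l)
      have "(\<Sum>i<k. (coord (X m) i - coord (X n) i)\<^sup>2) \<le> e\<^sup>2" if "n \<ge> M" for n
      proof -
        have "(\<Sum>i<k. (coord (X m - X n) i)\<^sup>2) \<le> (norm (X m - X n))\<^sup>2"
          by (rule sum_coord_sq_le)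
        also have "\<dots> \<le> e\<^sup>2"
          using M m that by (intro power_mono) (auto intro: less_imp_le)
        finally show ?thesis by simp
      qed
      then show "\<exists>N. \<forall>n\<ge>N. (\<Sum>i<k. (coord (X m) i - coord (X n) i)\<^sup>2) \<le> e\<^sup>2" by blast
    qed
    then show ?thesis by blast
  qed
  have summ: "summable (\<lambda>i. (f i)\<^sup>2)" if "\<And>k. (\<Sum>i<k. (f i)\<^sup>2) \<le> B" for f :: "nat \<Rightarrow> real" and B
    using that by (intro summableI_nonneg_bounded) auto
  obtain M where "\<And>k. (\<Sum>i<k. (coord (X M) i - l i)\<^sup>2) \<le> 1"
    using tail[of 1] by auto
  then have "summable (\<lambda>i. (coord (X M) i - l i)\<^sup>2)" by (rule summ)
  then have "summable (\<lambda>i. (l i - coord (X M) i)\<^sup>2)" by (simp add: power2_commute)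
  then have "summable (\<lambda>i. (l i - coord (X M) i + coord (X M) i)\<^sup>2)"
    by (rule summable_sq_add) (rule summable_coord_sq)
  then have L: "coord (Abs_ell2 l) = l"
    by (simp add: Abs_ell2_inverse)
  have "X \<longlonglongrightarrow> Abs_ell2 l"
  proof (rule LIMSEQ_I)
    fix r :: real assume r: "0 < r"
    then obtain M where M: "\<forall>m\<ge>M. \<forall>k. (\<Sum>i<k. (coord (X m) i - l i)\<^sup>2) \<le> (r / 2)\<^sup>2"
      using tail[of "r / 2"] by auto
    have "norm (X m - Abs_ell2 l) < r" if "m \<ge> M" for m
    proof -
      have "(norm (X m - Abs_ell2 l))\<^sup>2 \<le> (r / 2)\<^sup>2"
        unfolding norm_ell2_sq using M that
        by (intro suminf_le_const summable_coord_sq) (simp add: L)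
      then have "norm (X m - Abs_ell2 l) \<le> r / 2"
        by (rule power2_le_imp_le) (use r in simp)
      with r show ?thesis by linarith
    qed
    then show "\<exists>no. \<forall>n\<ge>no. norm (X n - Abs_ell2 l) < r" by blast
  qed
  then show "convergent X" by (rule convergentI)
qed

definition ell2_fin :: "ell2 set" where
  "ell2_fin = {x. finite {i. coord x i \<noteq> 0}}"

definition H_tilde :: "(nat \<Rightarrow> real) \<Rightarrow> ell2 set" where
  "H_tilde a = {x. summable (\<lambda>i. (coord x i)\<^sup>2 / (a i) ^ 4)}"

definition finitely_convex :: "ell2 set \<Rightarrow> bool" where
  "finitely_convex \<Omega> \<longleftrightarrow>
    (\<forall>x\<in>\<Omega>. \<forall>y\<in>\<Omega>. x - y \<in> ell2_fin \<longrightarrow> {t *\<^sub>R x + (1 - t) *\<^sub>R y | t. t \<in> {0..1}} \<subseteq> \<Omega>)"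

definition strong_segment_condition :: "(nat \<Rightarrow> real) \<Rightarrow> ell2 set \<Rightarrow> bool" where
  "strong_segment_condition a \<Omega> \<longleftrightarrow>
    (\<forall>x\<in>frontier \<Omega>. \<exists>U y. open U \<and> x \<in> U \<and> y \<in> H_tilde a \<and> y \<noteq> 0 \<and>
      (\<forall>z\<in>closure \<Omega> \<inter> U. \<forall>t\<in>{0<..<1}. z + t *\<^sub>R y \<in> \<Omega>))"

end

theory Submission
  imports Defs
begin

text \<open>Since \<open>ell2_fin\<close> is dense, an open finitely convex set \<open>\<Omega>\<close> is convex: a point
  \<open>t x + (1 - t) y\<close> is unchanged when \<open>x\<close> and \<open>y\<close> are moved slightly in opposite directions, so
  that their difference becomes finitely supported. By density again, a frontier point \<open>x\<close> admits
  a finitely supported \<open>y\<close> with \<open>x + y \<in> \<Omega>\<close>. For \<open>z\<close> in the closure of \<open>\<Omega>\<close> and close to \<open>x\<close>,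
  the point \<open>z + y\<close> still lies in \<open>\<Omega>\<close>, and so does the half-open segment from \<open>z\<close> to it.\<close>

text \<open>Density of \<open>ell2_fin\<close>, with the error vector \<open>h\<close> as witness:
  \<open>h\<close> is a tail of \<open>x\<close>, small because the tails of a convergent series
  tend to 0.\<close>

lemma ell2_fin_approx:
  fixes x :: ell2
  assumes "0 < e"
  obtains h where "norm h < e" "x - h \<in> ell2_fin"
proof -
  from assms have "0 < e\<^sup>2" by simp
  then obtain n where n: "norm (\<Sum>i. (coord x (i + n))\<^sup>2) < e\<^sup>2"
    using suminf_exist_split[OF _ summable_coord_sq[of x]] by blast
  define f where "f i = (if i < n then 0 else coord x i)" for i
  have sf: "summable (\<lambda>i. (f i)\<^sup>2)"
    by (rule summable_comparison_test'[OF summable_coord_sq[of x]]) (simp add: f_def)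
  define h where "h = Abs_ell2 f"
  have h: "coord h i = f i" for i
    using sf by (simp add: h_def Abs_ell2_inverse)
  have "(norm h)\<^sup>2 = (\<Sum>i. (f (i + n))\<^sup>2) + (\<Sum>i<n. (f i)\<^sup>2)"
    unfolding norm_ell2_sq h by (rule suminf_split_initial_segment[OF sf])
  also have "\<dots> = (\<Sum>i. (coord x (i + n))\<^sup>2)"
    by (simp add: f_def)
  also have "\<dots> < e\<^sup>2" using n by simp
  finally have "norm h < e"
    using assms by (intro power2_less_imp_less[of "norm h" e]) auto
  moreover have "{i. coord (x - h) i \<noteq> 0} \<subseteq> {..<n}"
    by (auto simp: h f_def split: if_splits)
  then have "x - h \<in> ell2_fin"
    unfolding ell2_fin_def using finite_subset by blast
  ultimately show ?thesis by (rule that)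
qed

lemma ell2_fin_subset_H_tilde: "ell2_fin \<subseteq> H_tilde a"
proof
  fix x assume "x \<in> ell2_fin"
  then have "finite {i. coord x i \<noteq> 0}" by (simp add: ell2_fin_def)
  then have "summable (\<lambda>i. (coord x i)\<^sup>2 / a i ^ 4)"
    by (rule summable_finite) simp
  then show "x \<in> H_tilde a" by (simp add: H_tilde_def)
qed

lemma open_finitely_convex_imp_convex:
  assumes "open \<Omega>" and "finitely_convex \<Omega>"
  shows "convex \<Omega>"
proof -
  have "t *\<^sub>R x + (1 - t) *\<^sub>R y \<in> \<Omega>"
    if xy: "x \<in> \<Omega>" "y \<in> \<Omega>" and t: "0 \<le> t" "t \<le> 1" for x y t
  proof -
    obtain r where r: "0 < r" "ball x r \<subseteq> \<Omega>"
      using \<open>open \<Omega>\<close> xy by (auto simp: open_contains_ball)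
    obtain s where s: "0 < s" "ball y s \<subseteq> \<Omega>"
      using \<open>open \<Omega>\<close> xy by (auto simp: open_contains_ball)
    obtain h where h: "norm h < min r s" "(x - y) - h \<in> ell2_fin"
      using ell2_fin_approx[of "min r s" "x - y"] r s by auto
    \<comment> \<open>The weights make the shifts cancel in the combination,
      \<open>-t * (1 - t) + (1 - t) * t = 0\<close>, while the difference becomes
      \<open>x' - y' = (x - y) - h\<close>.\<close>
    define x' y' where "x' = x - (1 - t) *\<^sub>R h" and "y' = y + t *\<^sub>R h"
    have "norm ((1 - t) *\<^sub>R h) \<le> norm h" "norm (t *\<^sub>R h) \<le> norm h"
      using t by (auto intro: mult_left_le_one_le)
    with h have "x' \<in> ball x r" "y' \<in> ball y s"
      by (auto simp: x'_def y'_def dist_norm)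
    with r s have "x' \<in> \<Omega>" "y' \<in> \<Omega>" by auto
    moreover have "x' - y' \<in> ell2_fin"
      using h by (simp add: x'_def y'_def algebra_simps)
    ultimately have "t *\<^sub>R x' + (1 - t) *\<^sub>R y' \<in> \<Omega>"
      using assms(2) t unfolding finitely_convex_def by fastforce
    moreover have "t *\<^sub>R x' + (1 - t) *\<^sub>R y' = t *\<^sub>R x + (1 - t) *\<^sub>R y"
      by (simp add: x'_def y'_def algebra_simps)
    ultimately show ?thesis by simp
  qed
  then show ?thesis by (force simp: convex_alt add.commute)
qed

text \<open>Replace \<open>z\<close> by a nearby \<open>z'\<close> in \<open>S\<close> and shift
  \<open>p\<close> to compensate, keeping the combination fixed; the ball around \<open>p\<close>
  absorbs the shift.\<close>

lemma open_convex_closure_segment: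
  fixes S :: "'a::real_normed_vector set"
  assumes "open S" "convex S" and z: "z \<in> closure S" and p: "p \<in> S" and t: "0 < t" "t \<le> 1"
  shows "(1 - t) *\<^sub>R z + t *\<^sub>R p \<in> S"
proof -
  obtain r where r: "0 < r" "ball p r \<subseteq> S"
    using \<open>open S\<close> p by (auto simp: open_contains_ball)
  \<comment> \<open>The shift of \<open>p\<close> is \<open>(1 - t) / t\<close> times
    \<open>z - z'\<close>, so the tolerance \<open>t * r\<close> keeps it below
    \<open>r\<close>.\<close>
  obtain z' where z': "z' \<in> S" "dist z' z < t * r"
    using z r t by (meson closure_approachable mult_pos_pos)
  define p' where "p' = p + ((1 - t) / t) *\<^sub>R (z - z')"
  have "norm (((1 - t) / t) *\<^sub>R (z - z')) = ((1 - t) / t) * dist z' z"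
    using t by (simp add: dist_norm norm_minus_commute)
  also have "\<dots> \<le> (1 / t) * dist z' z"
    using t by (intro mult_right_mono divide_right_mono) auto
  also have "\<dots> < r" using z' t by (simp add: field_simps)
  finally have "p' \<in> ball p r" by (simp add: p'_def dist_norm)
  with r have "p' \<in> S" by auto
  then have "(1 - t) *\<^sub>R z' + t *\<^sub>R p' \<in> S"
    using \<open>convex S\<close> z' t by (simp add: convex_alt)
  moreover have "t *\<^sub>R p' = t *\<^sub>R p + (1 - t) *\<^sub>R (z - z')"
    using t by (simp add: p'_def scaleR_add_right)
  then have "(1 - t) *\<^sub>R z' + t *\<^sub>R p' = (1 - t) *\<^sub>R z + t *\<^sub>R p"
    by (simp add: algebra_simps)
  ultimately show ?thesis by simp
qed

theorem proposition6p8: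
  fixes a :: "nat \<Rightarrow> real" and \<Omega> :: "ell2 set"
  assumes "\<And>i. a i > 0" and "summable a"
    and "open \<Omega>" and "\<Omega> \<noteq> {}"
    and "finitely_convex \<Omega>"
  shows "strong_segment_condition a \<Omega>"
  unfolding strong_segment_condition_def
proof
  fix x assume "x \<in> frontier \<Omega>"
  with \<open>open \<Omega>\<close> have x: "x \<notin> \<Omega>"
    by (simp add: frontier_def interior_open)
  from \<open>\<Omega> \<noteq> {}\<close> obtain w where "w \<in> \<Omega>" by blast
  with \<open>open \<Omega>\<close> obtain r where r: "0 < r" "ball w r \<subseteq> \<Omega>"
    by (auto simp: open_contains_ball)
  obtain h where h: "norm h < r" "(w - x) - h \<in> ell2_fin"
    using ell2_fin_approx r by blast
  \<comment> \<open>Chosen so that \<open>x + y = w - h\<close>, a point of the ball around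
    \<open>w\<close>.\<close>
  define y where "y = (w - x) - h"
  have "w - h \<in> ball w r" using h by (simp add: dist_norm)
  with r have xy: "x + y \<in> \<Omega>" by (auto simp: y_def)
  define U where "U = (\<lambda>z. z + y) -` \<Omega>"
  have "open U" unfolding U_def
    by (intro open_vimage \<open>open \<Omega>\<close> continuous_intros)
  moreover have "x \<in> U" using xy by (simp add: U_def)
  moreover have "y \<in> H_tilde a"
    using h ell2_fin_subset_H_tilde by (auto simp: y_def)
  \<comment> \<open>The point \<open>x\<close> lies outside the open set, \<open>x + y\<close>
    inside.\<close>
  moreover have "y \<noteq> 0" using x xy by auto
  moreover have "z + t *\<^sub>R y \<in> \<Omega>" if "z \<in> closure \<Omega> \<inter> U" "t \<in> {0<..<1}" for z t
  proof -
    \<comment> \<open>This combination is \<open>z + t *\<^sub>R y\<close>; membership of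
      \<open>z\<close> in \<open>U\<close> means exactly that its endpoint \<open>z + y\<close> is
      in \<Omega>.\<close>
    have "(1 - t) *\<^sub>R z + t *\<^sub>R (z + y) \<in> \<Omega>"
      using that open_finitely_convex_imp_convex assms
      by (intro open_convex_closure_segment) (auto simp: U_def)
    then show ?thesis by (simp add: algebra_simps)
  qed
  ultimately show "\<exists>U y. open U \<and> x \<in> U \<and> y \<in> H_tilde a \<and> y \<noteq> 0 \<and>
      (\<forall>z\<in>closure \<Omega> \<inter> U. \<forall>t\<in>{0<..<1}. z + t *\<^sub>R y \<in> \<Omega>)"
    by blast
qed

end
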